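(* Let $C\subseteq\mathbb{R}^d$ be a closed convex set and let $F\colon C\to\mathbb{R}^d$ be monotone and $L$-Lipschitz with $L>0$. Assume that the variational inequality "find $z^*\in C$ such that $\langle F(z^* ), z-z^*\rangle\ge 0$ for all $z\in C$" has at least one solution, and let $z^*$ be a solution. Let $0<\alpha\le \frac1L$ and let $(z^k)_{k\ge0}$, $(\bar z^k)_{k\ge 0}$ be generated by GRAAL with $\phi=2$ and step size $\alpha$. Then $(z^k)$ and $(\bar z^k)$ are bounded sequences. In particular, for all $k\ge 0$, $$\|\bar z^k-z^*\|^2\le 4\left(\|z^1-z^*\|^2+\|z^0-z^*\|^2\right)\le 12\|z^0-z^*\|^2 .$$
   Context: $F$ is monotone if $\langle F(x)-F(y),x-y\rangle\ge0$ for all $x,y\in C$, and $L$-Lipschitz if $\|F(x)-F(y)\|\le L\|x-y\|$ for all $x,y\in C$. $\|\cdot\|$ is the Euclidean norm and $P_C$ is the Euclidean projection onto $C$. GRAAL with parameter $\phi$ and constant step size $\alpha$ starts from $\bar z^{-1}=z^0\in C$ and iterates, for $k\ge0$, $$\bar z^k=\frac{\phi-1}{\phi}z^k+\frac1\phi\bar z^{k-1},\qquad z^{k+1}=P_C(\bar z^k-\alpha F(z^k)).$$ In particular $\bar z^0=z^0$. *)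

theory Defs
  imports "HOL-Analysis.Analysis"
begin

text \<open>
  The Euclidean projection onto \<open>C\<close> is \<^const>\<open>closest_point\<close>, and Lipschitz continuity is
  \<^const>\<open>lipschitz_on\<close>. An operator \<open>C \<rightarrow> \<real>\<^sup>d\<close> is a total function whose values outside \<open>C\<close>
  are irrelevant.
\<close>

definition monotone_operator_on :: "'a::real_inner set \<Rightarrow> ('a \<Rightarrow> 'a) \<Rightarrow> bool" where
  "monotone_operator_on C F \<longleftrightarrow> (\<forall>x\<in>C. \<forall>y\<in>C. (F x - F y) \<bullet> (x - y) \<ge> 0)"

definition VI_solution :: "'a::real_inner set \<Rightarrow> ('a \<Rightarrow> 'a) \<Rightarrow> 'a \<Rightarrow> bool" where
  "VI_solution C F zs \<longleftrightarrow> zs \<in> C \<and> (\<forall>z\<in>C. F zs \<bullet> (z - zs) \<ge> 0)"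

text \<open>
  The sequences \<open>z k\<close> and \<open>zbar k\<close> are indexed by \<open>k \<ge> 0\<close>; the initial value
  \<open>zbar (-1) = z 0\<close> of the recursion appears as the case \<open>k = 0\<close> of the conditional.
\<close>

definition GRAAL ::
  "'a::euclidean_space set \<Rightarrow> ('a \<Rightarrow> 'a) \<Rightarrow> real \<Rightarrow> real \<Rightarrow> (nat \<Rightarrow> 'a) \<Rightarrow> (nat \<Rightarrow> 'a) \<Rightarrow> bool" where
  "GRAAL C F \<phi> \<alpha> z zbar \<longleftrightarrow>
     z 0 \<in> C \<and>
     (\<forall>k. zbar k = ((\<phi> - 1) / \<phi>) *\<^sub>R z k + (1 / \<phi>) *\<^sub>R (if k = 0 then z 0 else zbar (k - 1))) \<and>
     (\<forall>k. z (Suc k) = closest_point C (zbar k - \<alpha> *\<^sub>R F (z k)))"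

end

theory Submission
  imports Defs
begin

text \<open>
  Adding the projection inequalities of two consecutive steps shows that
  \<open>V k = 2 \<langle>z k - z*, zbar (k-1) - z*\<rangle> + \<parallel>z k - z (k-1)\<parallel>\<^sup>2\<close> is nonincreasing, with
  \<open>V 1 = S = \<parallel>z 1 - z*\<parallel>\<^sup>2 + \<parallel>z 0 - z*\<parallel>\<^sup>2\<close>. The function \<open>V\<close> may be negative, but with
  \<open>u\<close>, \<open>p\<close>, \<open>q\<close> the values of \<open>zbar - z*\<close> at \<open>k\<close>, \<open>k-1\<close>, \<open>k-2\<close> and \<open>v = 2 p - q = z (k-1) - z*\<close>,
  the bound \<open>V k \<le> S\<close> reads \<open>\<parallel>2 u - v\<parallel>\<^sup>2 + 3 \<parallel>p - q/3\<parallel>\<^sup>2 \<le> S + \<parallel>q\<parallel>\<^sup>2/3\<close>. Hence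
  \<open>\<parallel>q\<parallel>\<^sup>2 \<le> 4 S\<close> propagates to \<open>\<parallel>u\<parallel>\<^sup>2 \<le> 4 S\<close>.
\<close>

lemma inner_le_half_norm_squares:
  fixes g x :: "'a::real_inner"
  assumes "norm g \<le> r"
  shows "2 * (g \<bullet> x) \<le> r\<^sup>2 + (norm x)\<^sup>2"
proof -
  have "g \<bullet> x \<le> norm g * norm x"
    by (rule norm_cauchy_schwarz)
  also have "\<dots> \<le> r * norm x"
    using assms by (simp add: mult_right_mono)
  finally show ?thesis
    using sum_squares_bound[of r "norm x"] by simp
qed

text \<open>The letters \<open>w\<close>, \<open>x\<close>, \<open>y\<close> are consecutive
  iterates, \<open>p\<close>, \<open>q\<close> are averages and \<open>f\<close>, \<open>g\<close>
  are operator values scaled by the step size. Substituting \<open>p = 2 q - x\<close>, which is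
  where \<phi> = 2 enters, in twice the sum of the projection inequalities leaves
  \<open>2 (g - f) \<bullet> (x - y)\<close> as the only operator term besides the one that
  \<open>mono\<close> discards. Young's inequality bounds it, and the rest matches the claim
  exactly.\<close>

lemma GRAAL_energy_step:
  fixes s w x y p q f g :: "'a::real_inner"
  assumes q: "q = (1/2) *\<^sub>R x + (1/2) *\<^sub>R p"
    and proj_y: "(q - g - y) \<bullet> (s - y) \<le> 0"
    and proj_x: "(p - f - x) \<bullet> (y - x) \<le> 0"
    and mono: "g \<bullet> (s - x) \<le> 0"
    and lip: "norm (g - f) \<le> norm (x - w)"
  shows "2 * ((y - s) \<bullet> (q - s)) + (norm (y - x))\<^sup>2
       \<le> 2 * ((x - s) \<bullet> (p - s)) + (norm (x - w))\<^sup>2"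
proof -
  have "2 * ((g - f) \<bullet> (x - y)) \<le> (norm (x - w))\<^sup>2 + (norm (x - y))\<^sup>2"
    by (rule inner_le_half_norm_squares[OF lip])
  moreover have "p = 2 *\<^sub>R q - x"
    by (simp add: q scaleR_add_right)
  ultimately show ?thesis
    using proj_y proj_x mono
    by (simp add: power2_norm_eq_inner inner_diff_left inner_diff_right inner_commute)
qed

lemma norm_square_le_of_energy_le:
  fixes u p q :: "'a::real_inner"
  assumes energy: "2 * ((2 *\<^sub>R u - p) \<bullet> p) + (norm (2 *\<^sub>R u - p - (2 *\<^sub>R p - q)))\<^sup>2 \<le> S"
    and q: "(norm q)\<^sup>2 \<le> 4 * S"
  shows "(norm u)\<^sup>2 \<le> 4 * S"
proof -
  define e where "e = 2 *\<^sub>R u - (2 *\<^sub>R p - q)"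
  define w where "w = 3 *\<^sub>R p - q"
  have p: "p = (1/3) *\<^sub>R w + (1/3) *\<^sub>R q"
    by (simp add: w_def scaleR_diff_right)
  have "(1/2) *\<^sub>R q = (1/3) *\<^sub>R q + (1/6) *\<^sub>R q"
    by (simp flip: scaleR_add_left)
  then have u: "u = (1/2) *\<^sub>R e + (1/3) *\<^sub>R w - (1/6) *\<^sub>R q"
    by (simp add: e_def w_def scaleR_diff_right)
  have energy': "(norm e)\<^sup>2 + (norm w)\<^sup>2 / 3 \<le> S + (norm q)\<^sup>2 / 3"
    using energy unfolding p u
    by (simp add: power2_norm_eq_inner inner_diff_left inner_diff_right inner_add_left
        inner_add_right inner_commute algebra_simps)
  \<comment> \<open>The three squares are the slack in the Cauchy--Schwarz inequality for
    \<open>2 u = 1 * e + (2 / sqrt 3) * (w / sqrt 3) + (1/3) * (- q)\<close>.\<close>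
  have "0 \<le> (norm (2 *\<^sub>R e - w))\<^sup>2 / 3 + (norm (e + 3 *\<^sub>R q))\<^sup>2 / 9 + (norm (w + 6 *\<^sub>R q))\<^sup>2 / 27"
    by simp
  also have "\<dots> = (22/9) * ((norm e)\<^sup>2 + (norm w)\<^sup>2 / 3 + (norm q)\<^sup>2) - 4 * (norm u)\<^sup>2"
    unfolding u
    by (simp add: power2_norm_eq_inner inner_diff_left inner_diff_right inner_add_left
        inner_add_right inner_commute field_simps)
  \<comment> \<open>The factor 22/9 is 1 + 4/3 + 1/9. The two bounds give 4 |u|^2 \<le> (22/9) (S +
    (4/3) |q|^2) \<le> (418/27) S, and 418/27 < 16; that S is nonnegative follows from 0 \<le> |q|^2
    \<le> 4 S.\<close>
  finally show ?thesis
    using energy' q zero_le_power2[of "norm q"] by argo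
qed

lemma GRAAL_mem:
  assumes "GRAAL C F \<phi> \<alpha> z zbar" "closed C"
  shows "z k \<in> C"
proof -
  have "z 0 \<in> C" and "z (Suc n) = closest_point C (zbar n - \<alpha> *\<^sub>R F (z n))" for n
    using assms(1) unfolding GRAAL_def by blast+
  then show ?thesis
    using closest_point_in_set[OF assms(2)] by (cases k) auto
qed

text \<open>Monotonicity turns the Stampacchia form of the variational inequality into its Minty
  form.\<close>

lemma VI_solution_inner_nonpos:
  assumes "VI_solution C F s" "monotone_operator_on C F" "x \<in> C"
  shows "F x \<bullet> (s - x) \<le> 0"
proof -
  have "0 \<le> (F x - F s) \<bullet> (x - s)" "0 \<le> F s \<bullet> (x - s)"
    using assms by (auto simp: VI_solution_def monotone_operator_on_def)
  then show ?thesis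
    by (simp add: inner_diff_left inner_diff_right)
qed

lemma scaled_lipschitz_norm_le:
  fixes F :: "'a::real_normed_vector \<Rightarrow> 'b::real_normed_vector"
  assumes "L-lipschitz_on C F" "L > 0" "0 < \<alpha>" "\<alpha> \<le> 1 / L" "x \<in> C" "y \<in> C"
  shows "norm (\<alpha> *\<^sub>R F x - \<alpha> *\<^sub>R F y) \<le> norm (x - y)"
proof -
  have "norm (\<alpha> *\<^sub>R F x - \<alpha> *\<^sub>R F y) = \<alpha> * norm (F x - F y)"
    using assms by (simp flip: scaleR_diff_right)
  also have "\<dots> \<le> \<alpha> * (L * norm (x - y))"
    using lipschitz_onD[OF assms(1,5,6)] assms by (simp add: dist_norm)
  also have "\<dots> = (\<alpha> * L) * norm (x - y)"
    by simp
  also have "\<dots> \<le> 1 * norm (x - y)"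
    using assms by (intro mult_right_mono) (auto simp: field_simps)
  finally show ?thesis
    by simp
qed

text \<open>Test the projection at \<open>y\<close> with \<open>s\<close>. Monotonicity and the
  solution property reduce the operator term to \<open>(F x - F s) \<bullet> (x - y)\<close>; after
  Young's inequality the squares of \<open>x - y\<close> cancel.\<close>

lemma projected_step_norm_square_le:
  fixes F :: "'a::euclidean_space \<Rightarrow> 'a"
  assumes "closed C" "convex C" "monotone_operator_on C F" "VI_solution C F s"
    and "L-lipschitz_on C F" "L > 0" "0 < \<alpha>" "\<alpha> \<le> 1 / L" "x \<in> C"
    and y: "y = closest_point C (x - \<alpha> *\<^sub>R F x)"
  shows "(norm (y - s))\<^sup>2 \<le> 2 * (norm (x - s))\<^sup>2"
proof -
  have s: "s \<in> C"
    using assms by (simp add: VI_solution_def)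
  have yC: "y \<in> C"
    using assms by (auto simp: y intro!: closest_point_in_set)
  have "(x - \<alpha> *\<^sub>R F x - y) \<bullet> (s - y) \<le> 0"
    unfolding y using assms s by (intro closest_point_dot)
  moreover have "0 \<le> \<alpha> * (F s \<bullet> (y - s))" "0 \<le> \<alpha> * ((F x - F s) \<bullet> (x - s))"
    using assms s yC by (auto simp: VI_solution_def monotone_operator_on_def)
  moreover have "2 * ((\<alpha> *\<^sub>R F x - \<alpha> *\<^sub>R F s) \<bullet> (x - y)) \<le> (norm (x - s))\<^sup>2 + (norm (x - y))\<^sup>2"
    using assms s by (intro inner_le_half_norm_squares scaled_lipschitz_norm_le)
  ultimately show ?thesis
    by (simp add: power2_norm_eq_inner inner_diff_left inner_diff_right inner_commute algebra_simps)
qed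

theorem theorem1:
  fixes C :: "'a::euclidean_space set"
    and F :: "'a \<Rightarrow> 'a"
    and L \<alpha> :: real
    and zs :: 'a
    and z zbar :: "nat \<Rightarrow> 'a"
  assumes "closed C" and "convex C"
    and "monotone_operator_on C F"
    and "L > 0" and "L-lipschitz_on C F"
    and "VI_solution C F zs"
    and "0 < \<alpha>" and "\<alpha> \<le> 1 / L"
    and "GRAAL C F 2 \<alpha> z zbar"
  shows "bounded (range z) \<and> bounded (range zbar) \<and>
    (\<forall>k. (norm (zbar k - zs))\<^sup>2 \<le> 4 * ((norm (z 1 - zs))\<^sup>2 + (norm (z 0 - zs))\<^sup>2) \<and>
         4 * ((norm (z 1 - zs))\<^sup>2 + (norm (z 0 - zs))\<^sup>2) \<le> 12 * (norm (z 0 - zs))\<^sup>2)"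
proof -
  define S where "S = (norm (z 1 - zs))\<^sup>2 + (norm (z 0 - zs))\<^sup>2"
  have zC: "z k \<in> C" for k
    using assms by (intro GRAAL_mem)
  have zsC: "zs \<in> C"
    using assms by (simp add: VI_solution_def)
  have z_Suc: "z (Suc k) = closest_point C (zbar k - \<alpha> *\<^sub>R F (z k))" for k
    using assms by (simp add: GRAAL_def)
  have zbar_eq: "zbar k = (1/2) *\<^sub>R z k + (1/2) *\<^sub>R (if k = 0 then z 0 else zbar (k - 1))" for k
    using assms(9) unfolding GRAAL_def by simp
  have zbar_0: "zbar 0 = z 0"
    by (simp add: zbar_eq[of 0] flip: scaleR_add_left)
  have zbar_Suc: "zbar (Suc k) = (1/2) *\<^sub>R z (Suc k) + (1/2) *\<^sub>R zbar k" for k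
    by (simp add: zbar_eq[of "Suc k"])
  have z_Suc_zbar: "z (Suc k) = 2 *\<^sub>R zbar (Suc k) - zbar k" for k
    by (simp add: zbar_Suc scaleR_add_right)

  have proj: "(zbar k - \<alpha> *\<^sub>R F (z k) - z (Suc k)) \<bullet> (c - z (Suc k)) \<le> 0" if "c \<in> C" for k c
    unfolding z_Suc using assms that by (intro closest_point_dot)
  have energy: "2 * ((z (Suc k) - zs) \<bullet> (zbar k - zs)) + (norm (z (Suc k) - z k))\<^sup>2 \<le> S" for k
  proof (induction k)
    case 0
    \<comment> \<open>As \<open>zbar 0 = z 0\<close>, polarization makes this an equality.\<close>
    show ?case
      by (simp add: S_def zbar_0 power2_norm_eq_inner inner_diff_left inner_diff_right inner_commute)
  next
    case (Suc k)
    have "(\<alpha> *\<^sub>R F (z (Suc k))) \<bullet> (zs - z (Suc k)) \<le> 0"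
      using VI_solution_inner_nonpos[OF assms(6,3) zC[of "Suc k"]] assms(7)
      by (simp add: mult_nonneg_nonpos)
    moreover have "norm (\<alpha> *\<^sub>R F (z (Suc k)) - \<alpha> *\<^sub>R F (z k)) \<le> norm (z (Suc k) - z k)"
      using assms zC by (intro scaled_lipschitz_norm_le)
    ultimately show ?case
      using GRAAL_energy_step[OF zbar_Suc proj[OF zsC] proj[OF zC]] Suc.IH by fastforce
  qed

  have "S \<ge> 0"
    by (simp add: S_def)
  \<comment> \<open>The bound at index k + 2 is derived from the one at k, so indices 0 and 1 both
    need a direct argument.\<close>
  have zbar_le: "(norm (zbar k - zs))\<^sup>2 \<le> 4 * S" for k
  proof (induction k rule: induct_nat_012)
    case 0
    then show ?case
      using \<open>S \<ge> 0\<close> by (simp add: zbar_0 S_def)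
  next
    case 1
    have "zbar 1 - zs = (1/2) *\<^sub>R ((z 1 - zs) + (z 0 - zs))"
      using zbar_Suc[of 0] by (simp add: zbar_0 algebra_simps flip: scaleR_add_left)
    then have "(norm (zbar 1 - zs))\<^sup>2 = (norm ((z 1 - zs) + (z 0 - zs)))\<^sup>2 / 4"
      by (simp add: power2_eq_square)
    moreover have "(norm ((z 1 - zs) + (z 0 - zs)))\<^sup>2 \<le> 2 * S"
      using inner_le_half_norm_squares[OF order_refl, of "z 1 - zs" "z 0 - zs"]
      unfolding S_def power2_norm_eq_inner
      by (simp add: inner_add_left inner_add_right inner_commute)
    ultimately show ?case
      using \<open>S \<ge> 0\<close> by simp
  next
    case (ge2 k)
    \<comment> \<open>Taking \<open>zs\<close> as the origin puts the energy in the shape of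
      \<open>norm_square_le_of_energy_le\<close>.\<close>
    have 1: "z (Suc (Suc k)) - zs = 2 *\<^sub>R (zbar (Suc (Suc k)) - zs) - (zbar (Suc k) - zs)"
      and 2: "z (Suc k) - zs = 2 *\<^sub>R (zbar (Suc k) - zs) - (zbar k - zs)"
      by (simp_all add: z_Suc_zbar scaleR_diff_right scaleR_2)
    have "z (Suc (Suc k)) - z (Suc k) = (z (Suc (Suc k)) - zs) - (z (Suc k) - zs)"
      by simp
    then show ?case
      using norm_square_le_of_energy_le[OF _ ge2(1)] energy[of "Suc k"] unfolding 1 2
      by metis
  qed

  have "dist zs (zbar k) \<le> sqrt (4 * S)" for k
    using zbar_le[of k] by (simp add: dist_norm norm_minus_commute real_le_rsqrt)
  then have bzbar: "bounded (range zbar)"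
    unfolding bounded_def by blast
  have "bounded (range (\<lambda>k. zbar (Suc k)))"
    by (rule bounded_subset[OF bzbar]) auto
  then have "bounded (range (\<lambda>k. z (Suc k)))"
    unfolding z_Suc_zbar using bzbar by (intro bounded_minus_comp bounded_scaleR_comp)
  moreover have "range z = insert (z 0) (range (\<lambda>k. z (Suc k)))"
    by (subst UNIV_nat_eq) (simp add: image_image)
  ultimately have bz: "bounded (range z)"
    by simp

  \<comment> \<open>Since \<open>zbar 0 = z 0\<close>, the first step is a plain projected step;
    this yields 12 = 4 (2 + 1).\<close>
  have "(norm (z 1 - zs))\<^sup>2 \<le> 2 * (norm (z 0 - zs))\<^sup>2"
    using assms zC[of 0] z_Suc[of 0] by (intro projected_step_norm_square_le) (auto simp: zbar_0)
  then show ?thesis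
    using bz bzbar zbar_le by (simp add: S_def)
qed

end
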